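(* For any (not necessarily unital) ring $R$ there are mutually inverse lattice isomorphisms $$\Phi:\mathcal L(\mathcal V(R))\to\mathrm{Tr}(R)\qquad\text{and}\qquad\Psi:\mathrm{Tr}(R)\to\mathcal L(\mathcal V(R))$$ given by the rules $$\Phi(I)=\langle\,\text{entries of }e\mid e\in\mathrm{Idem}(M_\infty(R))\text{ and }[e]\in I\,\rangle,$$ $$\Psi(J)=\{[e]\in\mathcal V(R)\mid e\in\mathrm{Idem}(M_\infty(J))\}.$$
   Context: For a ring $R$, $M_\infty(R)$ is the ring of $\omega\times\omega$ matrices over $R$ with finitely many nonzero entries, and $\mathrm{Idem}(M_\infty(R))$ is its set of idempotents. $\mathcal V(R)$ is the abelian monoid of Murray–von Neumann equivalence classes $[e]$ of idempotents $e\in M_\infty(R)$ ($e\sim f$ iff $e=xy$ and $f=yx$ for some $x,y\in M_\infty(R)$), with $[e]+[f]=[e\oplus f]$ (block diagonal sum). A two-sided ideal of $R$ is a trace ideal if it can be generated by the entries of the matrices in some subset of $\mathrm{Idem}(M_\infty(R))$; $\mathrm{Tr}(R)$ is the set of trace ideals, a complete lattice under inclusion. $\langle\cdot\rangle$ denotes the two-sided ideal generated. An order-ideal of an abelian monoid $M$ is a submonoid $I$ such that $x+y\in I$ implies $x,y\in I$; $\mathcal L(M)$ is the complete lattice of order-ideals under inclusion. *)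

theory Defs
  imports "HOL.Hull" "HOL-Library.Groups_Big_Fun" "HOL-Algebra.Complete_Lattice"
begin

text \<open>The class \<^class>\<open>ring\<close> does not require a unit.\<close>

typedef (overloaded) 'a minf = "{A :: nat \<Rightarrow> nat \<Rightarrow> 'a::zero. finite {(i, j). A i j \<noteq> 0}}"
  morphisms entry Abs_minf
  by (rule exI [of _ "\<lambda>_ _. 0"]) simp

setup_lifting type_definition_minf

definition supported :: "nat \<Rightarrow> 'a::zero minf \<Rightarrow> bool" where
  "supported n A \<longleftrightarrow> (\<forall>i j. entry A i j \<noteq> 0 \<longrightarrow> i < n \<and> j < n)"

lemma bounded_finite_support:
  fixes f :: "nat \<Rightarrow> nat \<Rightarrow> 'a::zero"
  assumes "\<And>i j. f i j \<noteq> 0 \<Longrightarrow> i < n \<and> j < m"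
  shows "finite {(i, j). f i j \<noteq> 0}"
  by (rule finite_subset [of _ "{..<n} \<times> {..<m}"]) (use assms in auto)

lemma finite_support_bounded:
  fixes f :: "nat \<Rightarrow> nat \<Rightarrow> 'a::zero"
  assumes "finite {(i, j). f i j \<noteq> 0}"
  obtains n where "\<And>i j. f i j \<noteq> 0 \<Longrightarrow> i < n \<and> j < n"
proof -
  let ?S = "{(i, j). f i j \<noteq> 0}"
  have f: "finite (fst ` ?S \<union> snd ` ?S)"
    using assms by simp
  obtain n where n: "\<And>k. k \<in> fst ` ?S \<union> snd ` ?S \<Longrightarrow> k < n"
    using f finite_nat_set_iff_bounded by (metis (no_types, lifting))
  show thesis
  proof (rule that)
    fix i j assume "f i j \<noteq> 0"
    then have "(i, j) \<in> ?S" by simp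
    then have "i \<in> fst ` ?S" "j \<in> snd ` ?S" by force+
    then show "i < n \<and> j < n" using n by blast
  qed
qed

lemma supported_exists: "\<exists>n. supported n A"
proof -
  have "finite {(i, j). entry A i j \<noteq> 0}"
    using entry [of A] by simp
  then show ?thesis
    unfolding supported_def by (rule finite_support_bounded) blast
qed

lemma supported_mono: "supported n A \<Longrightarrow> n \<le> m \<Longrightarrow> supported m A"
  unfolding supported_def by (meson order_less_le_trans)

lemma supported_zeroD:
  "supported n A \<Longrightarrow> n \<le> i \<Longrightarrow> entry A i j = 0"
  "supported n A \<Longrightarrow> n \<le> j \<Longrightarrow> entry A i j = 0"
  unfolding supported_def by (meson leD)+

lemma minf_eqI: "(\<And>i j. entry A i j = entry B i j) \<Longrightarrow> A = B"
  by (metis entry_inject ext)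

instantiation minf :: (ring) ring
begin

lift_definition zero_minf :: "'a minf" is "\<lambda>_ _. 0" by simp

lift_definition plus_minf :: "'a minf \<Rightarrow> 'a minf \<Rightarrow> 'a minf" is "\<lambda>A B i j. A i j + B i j"
  subgoal for A B
    by (rule finite_subset [of _ "{(i, j). A i j \<noteq> 0} \<union> {(i, j). B i j \<noteq> 0}"]) auto
  done

lift_definition uminus_minf :: "'a minf \<Rightarrow> 'a minf" is "\<lambda>A i j. - A i j" by simp

lift_definition minus_minf :: "'a minf \<Rightarrow> 'a minf \<Rightarrow> 'a minf" is "\<lambda>A B i j. A i j - B i j"
  subgoal for A B
    by (rule finite_subset [of _ "{(i, j). A i j \<noteq> 0} \<union> {(i, j). B i j \<noteq> 0}"]) auto
  done

lift_definition times_minf :: "'a minf \<Rightarrow> 'a minf \<Rightarrow> 'a minf"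
  is "\<lambda>A B i j. \<Sum>k. A i k * B k j"
proof -
  fix A B :: "nat \<Rightarrow> nat \<Rightarrow> 'a"
  assume A: "finite {(i, j). A i j \<noteq> 0}" and B: "finite {(i, j). B i j \<noteq> 0}"
  obtain n where n: "\<And>i j. A i j \<noteq> 0 \<Longrightarrow> i < n \<and> j < n"
    using A by (rule finite_support_bounded) blast
  obtain m where m: "\<And>i j. B i j \<noteq> 0 \<Longrightarrow> i < m \<and> j < m"
    using B by (rule finite_support_bounded) blast
  show "finite {(i, j). (\<Sum>k. A i k * B k j) \<noteq> 0}"
  proof (rule bounded_finite_support)
    fix i j assume "(\<Sum>k. A i k * B k j) \<noteq> 0"
    then obtain k where k: "A i k * B k j \<noteq> 0"
      by (rule Sum_any.not_neutral_obtains_not_neutral)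
    from k have "A i k \<noteq> 0" "B k j \<noteq> 0" by auto
    then show "i < n \<and> j < m" using n m by blast
  qed
qed

lemma entry_times_minf:
  assumes "supported n A \<or> supported n B"
  shows "entry (A * B) i j = (\<Sum>k<n. entry A i k * entry B k j)"
proof -
  have "entry (A * B) i j = (\<Sum>k. entry A i k * entry B k j)"
    by (simp add: times_minf.rep_eq)
  also have "\<dots> = (\<Sum>k<n. entry A i k * entry B k j)"
  proof (rule Sum_any.expand_superset)
    show "{a. entry A i a * entry B a j \<noteq> 0} \<subseteq> {..<n}"
    proof
      fix a assume "a \<in> {a. entry A i a * entry B a j \<noteq> 0}"
      then have "entry A i a \<noteq> 0" "entry B a j \<noteq> 0" by auto
      then show "a \<in> {..<n}" using assms unfolding supported_def by auto
    qed
  qed simp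
  finally show ?thesis .
qed

instance
proof
  fix A B C :: "'a minf"
  show "A + B + C = A + (B + C)" by transfer (simp add: add.assoc)
  show "A + B = B + A" by transfer (simp add: add.commute)
  show "0 + A = A" by transfer simp
  show "- A + A = 0" by transfer simp
  show "A - B = A + - B" by transfer simp
  obtain a b c where "supported a A" "supported b B" "supported c C"
    using supported_exists by metis
  then obtain n where s: "supported n A" "supported n B" "supported n C"
    using supported_mono [of a A "a + b + c"] supported_mono [of b B "a + b + c"]
      supported_mono [of c C "a + b + c"] by auto
  note e = entry_times_minf [of n]
  show "(A + B) * C = A * C + B * C"
    by (rule minf_eqI) (simp add: e s plus_minf.rep_eq distrib_right sum.distrib)
  show "A * (B + C) = A * B + A * C"
    by (rule minf_eqI) (simp add: e s plus_minf.rep_eq distrib_left sum.distrib)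
  show "A * B * C = A * (B * C)"
  proof (rule minf_eqI)
    fix i j
    have "entry (A * B * C) i j
        = (\<Sum>k<n. \<Sum>l<n. entry A i l * entry B l k * entry C k j)"
      by (simp add: e s sum_distrib_right)
    also have "\<dots> = (\<Sum>l<n. \<Sum>k<n. entry A i l * (entry B l k * entry C k j))"
      by (subst sum.swap) (simp add: mult.assoc)
    also have "\<dots> = entry (A * (B * C)) i j"
      by (simp add: e s sum_distrib_left)
    finally show "entry (A * B * C) i j = entry (A * (B * C)) i j" .
  qed
qed

end

definition entries :: "'a::zero minf \<Rightarrow> 'a set" where
  "entries A = {entry A i j | i j. True}"

definition Mat_over :: "'a::zero set \<Rightarrow> 'a minf set" where
  "Mat_over J = {A. entries A \<subseteq> J}"

text \<open>
  For an ideal \<open>J\<close> of \<open>R\<close>, the ring of matrices over \<open>J\<close> is rendered as the subset \<open>Mat_over J\<close> of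
  the matrices over \<open>R\<close>, so that an idempotent over \<open>J\<close> has a class in \<open>V(R)\<close>.
\<close>

definition idempotents :: "'b::times set \<Rightarrow> 'b set" where
  "idempotents X = {e \<in> X. e * e = e}"

lift_definition block_diag :: "nat \<Rightarrow> 'a::zero minf \<Rightarrow> 'a minf \<Rightarrow> 'a minf"
  is "\<lambda>n A B i j. if i < n \<and> j < n then A i j
        else if n \<le> i \<and> n \<le> j then B (i - n) (j - n) else 0"
proof -
  fix n and A B :: "nat \<Rightarrow> nat \<Rightarrow> 'a"
  assume "finite {(i, j). B i j \<noteq> 0}"
  then obtain m where m: "\<And>i j. B i j \<noteq> 0 \<Longrightarrow> i < m \<and> j < m"
    by (rule finite_support_bounded) blast
  show "finite {(i, j). (if i < n \<and> j < n then A i j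
        else if n \<le> i \<and> n \<le> j then B (i - n) (j - n) else 0) \<noteq> 0}"
    by (rule bounded_finite_support [where n = "n + m" and m = "n + m"])
      (force split: if_splits dest!: m)
qed

text \<open>
  A finitely supported matrix is regarded as a square matrix of the smallest possible size
  before the second block is appended.  Up to Murray--von Neumann equivalence any larger
  size gives the same result, see \<open>vclass_plus\<close> below.
\<close>

definition dsum :: "'a::zero minf \<Rightarrow> 'a minf \<Rightarrow> 'a minf"  (infixl \<open>\<oplus>\<^sub>d\<close> 65) where
  "A \<oplus>\<^sub>d B = block_diag (LEAST n. supported n A) A B"

lemma supported_Least: "supported (LEAST n. supported n A) A"
  using supported_exists by (rule LeastI_ex)

abbreviation shift :: "nat \<Rightarrow> 'a::ring minf \<Rightarrow> 'a minf" where
  "shift n B \<equiv> block_diag n 0 B"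

lemma entry_shift:
  "entry (shift n B) i j = (if n \<le> i \<and> n \<le> j then entry B (i - n) (j - n) else 0)"
  by (auto simp: block_diag.rep_eq zero_minf.rep_eq)

lemma block_diag_eq:
  fixes A B :: "'a::ring minf"
  assumes "supported n A"
  shows "block_diag n A B = A + shift n B"
proof (rule minf_eqI)
  fix i j
  show "entry (block_diag n A B) i j = entry (A + shift n B) i j"
    using supported_zeroD [OF assms, of i j] supported_zeroD [OF assms, of j i]
    by (auto simp: plus_minf.rep_eq zero_minf.rep_eq block_diag.rep_eq)
qed

lemma shift_orthogonal:
  fixes A B :: "'a::ring minf"
  assumes "supported n A"
  shows "A * shift n B = 0" "shift n B * A = 0"
  by (rule minf_eqI; simp add: entry_times_minf [of n] assms entry_shift zero_minf.rep_eq)+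

lemma sum_shift_aux:
  fixes g :: "nat \<Rightarrow> 'a::comm_monoid_add"
  shows "(\<Sum>k<n + m. if n \<le> k then g (k - n) else 0) = (\<Sum>k<m. g k)"
proof -
  have "(\<Sum>k<n + m. if n \<le> k then g (k - n) else 0)
      = (\<Sum>k\<in>{n..<n + m}. g (k - n))"
    by (rule sum.mono_neutral_cong_right) auto
  also have "\<dots> = (\<Sum>k<m. g k)"
    by (rule sum.reindex_bij_witness [of _ "\<lambda>k. k + n" "\<lambda>k. k - n"]) auto
  finally show ?thesis .
qed

lemma supported_shift: "supported m B \<Longrightarrow> supported (n + m) (shift n B)"
  by (force simp: supported_def entry_shift split: if_splits)

lemma shift_mult:
  fixes A B :: "'a::ring minf"
  shows "shift n A * shift n B = shift n (A * B)"
proof (rule minf_eqI)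
  fix i j
  obtain m where m: "supported m A" using supported_exists by blast
  have "entry (shift n A * shift n B) i j =
      (\<Sum>k<n + m. entry (shift n A) i k * entry (shift n B) k j)"
    using supported_shift [OF m, of n] by (intro entry_times_minf) simp
  also have "\<dots> = (\<Sum>k<n + m. if n \<le> k
      then (\<lambda>k. if n \<le> i \<and> n \<le> j then entry A (i - n) k * entry B k (j - n) else 0) (k - n)
      else 0)"
    by (rule sum.cong) (auto simp: entry_shift)
  also have "\<dots> = entry (shift n (A * B)) i j"
    by (subst sum_shift_aux) (auto simp: entry_shift entry_times_minf [of m] m)
  finally show "entry (shift n A * shift n B) i j = entry (shift n (A * B)) i j" .
qed

definition mvn :: "'b::times \<Rightarrow> 'b \<Rightarrow> bool" where
  "mvn e f \<longleftrightarrow> (\<exists>x y. e = x * y \<and> f = y * x)"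

lemma mvn_refl:
  fixes e :: "'b::ring" shows "e * e = e \<Longrightarrow> mvn e e"
  unfolding mvn_def by metis

lemma mvn_sym: "mvn e f \<Longrightarrow> mvn f e"
  unfolding mvn_def by blast

lemma mvn_trans:
  fixes e f g :: "'b::ring"
  assumes "e * e = e" "g * g = g" "mvn e f" "mvn f g"
  shows "mvn e g"
proof -
  obtain x y z w where *: "e = x * y" "f = y * x" "f = z * w" "g = w * z"
    using assms unfolding mvn_def by blast
  have yx: "y * x = z * w" using * by simp
  have "e = x * y * (x * y)" using assms(1) *(1) by simp
  also have "\<dots> = x * (y * x) * y" by (simp only: mult.assoc)
  also have "\<dots> = (x * z) * (w * y)" unfolding yx by (simp only: mult.assoc)
  finally have 1: "e = (x * z) * (w * y)" .
  have "g = w * z * (w * z)" using assms(2) *(4) by simp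
  also have "\<dots> = w * (z * w) * z" by (simp only: mult.assoc)
  also have "\<dots> = (w * y) * (x * z)" unfolding yx [symmetric] by (simp only: mult.assoc)
  finally show ?thesis using 1 unfolding mvn_def by blast
qed

lemma mvn_cornerE:
  fixes e f :: "'b::ring"
  assumes "e * e = e" "f * f = f" "mvn e f"
  obtains x y where "e = x * y" "f = y * x" "e * x = x" "x * f = x" "f * y = y" "y * e = y"
proof -
  obtain x y where *: "e = x * y" "f = y * x"
    using assms unfolding mvn_def by blast
  have a: "e * x = x * f" "f * y = y * e" using * by (simp_all add: mult.assoc)
  have ee: "e * (e * u) = e * u" "f * (f * u) = f * u" for u
    using assms(1,2) by (simp_all flip: mult.assoc)
  show thesis
  proof (rule that [of "e * x" "f * y"])
    have "e * x * (f * y) = e * (x * f) * y" by (simp only: mult.assoc)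
    also have "\<dots> = e * (e * (x * y))" unfolding a(1) [symmetric] by (simp only: mult.assoc)
    finally show "e = e * x * (f * y)"
      unfolding *(1) [symmetric] by (simp add: assms(1))
    have "f * y * (e * x) = f * (y * e) * x" by (simp only: mult.assoc)
    also have "\<dots> = f * (f * (y * x))" unfolding a(2) [symmetric] by (simp only: mult.assoc)
    finally show "f = f * y * (e * x)"
      unfolding *(2) [symmetric] by (simp add: assms(2))
    show "e * (e * x) = e * x" "f * (f * y) = f * y" by (rule ee)+
    show "e * x * f = e * x" unfolding a(1) by (simp add: mult.assoc assms(2))
    show "f * y * e = f * y" unfolding a(2) by (simp add: mult.assoc assms(1))
  qed
qed

lemma mvn_orthogonal_sum:
  fixes e f e' f' :: "'b::ring"
  assumes id: "e * e = e" "f * f = f" "e' * e' = e'" "f' * f' = f'"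
    and eq: "mvn e e'" "mvn f f'"
    and orth: "e * f = 0" "f * e = 0" "e' * f' = 0" "f' * e' = 0"
  shows "mvn (e + f) (e' + f')"
proof -
  obtain x y where x: "e = x * y" "e' = y * x" "e * x = x" "x * e' = x" "e' * y = y" "y * e = y"
    using mvn_cornerE [OF id(1,3) eq(1)] by metis
  obtain z w where z: "f = z * w" "f' = w * z" "f * z = z" "z * f' = z" "f' * w = w" "w * f = w"
    using mvn_cornerE [OF id(2,4) eq(2)] by metis
  have "x * w = (x * e') * (f' * w)" using x(4) z(5) by simp
  then have 1: "x * w = x * (e' * f') * w" by (simp only: mult.assoc)
  have "z * y = (z * f') * (e' * y)" using z(4) x(5) by simp
  then have 2: "z * y = z * (f' * e') * y" by (simp only: mult.assoc)
  have "y * z = (y * e) * (f * z)" using x(6) z(3) by simp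
  then have 3: "y * z = y * (e * f) * z" by (simp only: mult.assoc)
  have "w * x = (w * f) * (e * x)" using z(6) x(3) by simp
  then have 4: "w * x = w * (f * e) * x" by (simp only: mult.assoc)
  have 0: "x * w = 0" "z * y = 0" "y * z = 0" "w * x = 0"
    unfolding 1 2 3 4 orth by simp_all
  have "e + f = (x + z) * (y + w)" "e' + f' = (y + w) * (x + z)"
    using 0 x(1,2) z(1,2) by (simp_all add: distrib_left distrib_right)
  then show ?thesis unfolding mvn_def by blast
qed

lemma idem_orthogonal_sum:
  fixes e f :: "'b::ring"
  assumes "e * e = e" "f * f = f" "e * f = 0" "f * e = 0"
  shows "(e + f) * (e + f) = e + f"
  using assms by (simp add: distrib_left distrib_right)

lift_definition row_shift :: "nat \<Rightarrow> 'a::zero minf \<Rightarrow> 'a minf"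
  is "\<lambda>n A i j. if n \<le> i then A (i - n) j else 0"
proof -
  fix n and A :: "nat \<Rightarrow> nat \<Rightarrow> 'a"
  assume "finite {(i, j). A i j \<noteq> 0}"
  then obtain m where m: "\<And>i j. A i j \<noteq> 0 \<Longrightarrow> i < m \<and> j < m"
    by (rule finite_support_bounded) blast
  show "finite {(i, j). (if n \<le> i then A (i - n) j else 0) \<noteq> 0}"
    by (rule bounded_finite_support [where n = "n + m" and m = "n + m"])
      (force split: if_splits dest!: m)
qed

lift_definition col_shift :: "nat \<Rightarrow> 'a::zero minf \<Rightarrow> 'a minf"
  is "\<lambda>n A i j. if n \<le> j then A i (j - n) else 0"
proof -
  fix n and A :: "nat \<Rightarrow> nat \<Rightarrow> 'a"
  assume "finite {(i, j). A i j \<noteq> 0}"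
  then obtain m where m: "\<And>i j. A i j \<noteq> 0 \<Longrightarrow> i < m \<and> j < m"
    by (rule finite_support_bounded) blast
  show "finite {(i, j). (if n \<le> j then A i (j - n) else 0) \<noteq> 0}"
    by (rule bounded_finite_support [where n = "n + m" and m = "n + m"])
      (force split: if_splits dest!: m)
qed

lemma mvn_shift:
  fixes f :: "'a::ring minf"
  assumes "f * f = f"
  shows "mvn (shift n f) f"
proof -
  obtain m where m: "supported m f" using supported_exists by blast
  have r: "supported (n + m) (row_shift n f)"
    using m by (force simp: supported_def row_shift.rep_eq split: if_splits)
  have c: "supported (n + m) (col_shift n f)"
    using m by (force simp: supported_def col_shift.rep_eq split: if_splits)
  have "row_shift n f * col_shift n f = shift n (f * f)"
  proof (rule minf_eqI)
    fix i j
    have "supported (n + m) f" "supported (n + m) (row_shift n f)"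
      using m r supported_mono [of m f "n + m"] by simp_all
    then show "entry (row_shift n f * col_shift n f) i j = entry (shift n (f * f)) i j"
      by (auto simp: entry_times_minf [of "n + m"] entry_shift row_shift.rep_eq col_shift.rep_eq)
  qed
  moreover have "col_shift n f * row_shift n f = f * f"
  proof (rule minf_eqI)
    fix i j
    have "entry (col_shift n f * row_shift n f) i j
        = (\<Sum>k<n + m. if n \<le> k then (\<lambda>k. entry f i k * entry f k j) (k - n) else 0)"
      by (subst entry_times_minf [of "n + m"])
        (auto simp: c row_shift.rep_eq col_shift.rep_eq intro!: sum.cong)
    also have "\<dots> = entry (f * f) i j"
      by (subst sum_shift_aux) (simp add: entry_times_minf [of m] m)
    finally show "entry (col_shift n f * row_shift n f) i j = entry (f * f) i j" .
  qed
  ultimately show ?thesis using assms unfolding mvn_def by metis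
qed

lemma idem_block_diag:
  fixes e f :: "'a::ring minf"
  assumes "supported n e" "e * e = e" "f * f = f"
  shows "block_diag n e f * block_diag n e f = block_diag n e f"
  unfolding block_diag_eq [OF assms(1)]
  by (rule idem_orthogonal_sum) (simp_all add: shift_orthogonal shift_mult assms)

lemma mvn_block_diag:
  fixes e f e' f' :: "'a::ring minf"
  assumes id: "e * e = e" "f * f = f" "e' * e' = e'" "f' * f' = f'"
    and eq: "mvn e e'" "mvn f f'"
    and orth: "e' * f' = 0" "f' * e' = 0" and s: "supported n e"
  shows "mvn (block_diag n e f) (e' + f')"
  unfolding block_diag_eq [OF s]
proof (rule mvn_orthogonal_sum)
  show "shift n f * shift n f = shift n f" by (simp add: shift_mult id)
  then show "mvn (shift n f) f'" using mvn_trans mvn_shift eq(2) id by metis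
qed (simp_all add: assms shift_orthogonal)

text \<open>
  Type \<open>'a vmonoid\<close> is \<open>V(R)\<close> and \<open>vclass e\<close> is \<open>[e]\<close>.  The relation is partial: \<open>vclass e\<close> is
  meaningful only for idempotent \<open>e\<close>.
\<close>

quotient_type (overloaded) 'a vmonoid = "'a::ring minf" / partial:
  "\<lambda>e f. e \<in> idempotents UNIV \<and> f \<in> idempotents UNIV \<and> mvn e f"
  morphisms rep_vmonoid vclass
proof (rule part_equivpI)
  have "(0::'a minf) \<in> idempotents UNIV" by (simp add: idempotents_def)
  then show "\<exists>x::'a minf. x \<in> idempotents UNIV \<and> x \<in> idempotents UNIV \<and> mvn x x"
    using mvn_refl [of "0::'a minf"] by auto
  show "symp (\<lambda>e f::'a minf. e \<in> idempotents UNIV \<and> f \<in> idempotents UNIV \<and> mvn e f)"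
    by (auto intro!: sympI mvn_sym)
  show "transp (\<lambda>e f::'a minf. e \<in> idempotents UNIV \<and> f \<in> idempotents UNIV \<and> mvn e f)"
    by (rule transpI) (auto simp: idempotents_def intro: mvn_trans)
qed

lemma vclass_eq_iff:
  "e * e = e \<Longrightarrow> f * f = f \<Longrightarrow> vclass e = vclass f \<longleftrightarrow> mvn e f"
  using Quotient3_rel [OF Quotient3_vmonoid, of e f]
  by (auto simp: idempotents_def mvn_refl)

lemma vclass_cases:
  obtains e where "e * e = e" "x = vclass e"
proof -
  obtain e where "e \<in> idempotents UNIV" "x = vclass e"
    using Quotient3_abs_rep [OF Quotient3_vmonoid, of x]
      Quotient3_rep_reflp [OF Quotient3_vmonoid, of x] by metis
  then show thesis using that by (simp add: idempotents_def)
qed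

instantiation vmonoid :: (ring) comm_monoid_add
begin

lift_definition zero_vmonoid :: "'a vmonoid" is 0
  by (simp add: idempotents_def mvn_refl)

lift_definition plus_vmonoid :: "'a vmonoid \<Rightarrow> 'a vmonoid \<Rightarrow> 'a vmonoid" is "(\<oplus>\<^sub>d)"
proof -
  fix e e' f f' :: "'a minf"
  assume a: "e \<in> idempotents UNIV \<and> e' \<in> idempotents UNIV \<and> mvn e e'"
    and b: "f \<in> idempotents UNIV \<and> f' \<in> idempotents UNIV \<and> mvn f f'"
  let ?m = "LEAST n. supported n e'"
  have id: "e * e = e" "f * f = f" "e' * e' = e'" "f' * f' = f'"
    using a b by (simp_all add: idempotents_def)
  have "mvn (e \<oplus>\<^sub>d f) (e' + shift ?m f')"
    unfolding dsum_def
  proof (rule mvn_block_diag)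
    show "shift ?m f' * shift ?m f' = shift ?m f'" by (simp add: shift_mult id)
    then show "mvn f (shift ?m f')"
      using b id mvn_trans mvn_sym mvn_shift by metis
  qed (use a id in \<open>simp_all add: supported_Least shift_orthogonal\<close>)
  also have "e' + shift ?m f' = e' \<oplus>\<^sub>d f'"
    unfolding dsum_def by (rule block_diag_eq [symmetric]) (rule supported_Least)
  finally have "mvn (e \<oplus>\<^sub>d f) (e' \<oplus>\<^sub>d f')" .
  moreover have "e \<oplus>\<^sub>d f \<in> idempotents UNIV" "e' \<oplus>\<^sub>d f' \<in> idempotents UNIV"
    unfolding dsum_def idempotents_def by (simp_all add: idem_block_diag supported_Least id)
  ultimately show "e \<oplus>\<^sub>d f \<in> idempotents UNIV \<and> e' \<oplus>\<^sub>d f' \<in> idempotents UNIV \<and> mvn (e \<oplus>\<^sub>d f) (e' \<oplus>\<^sub>d f')"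
    by blast
qed

lemma vclass_plus_orthogonal:
  fixes e f e' f' :: "'a minf"
  assumes id: "e * e = e" "f * f = f" "e' * e' = e'" "f' * f' = f'"
    and eq: "mvn e e'" "mvn f f'"
    and orth: "e' * f' = 0" "f' * e' = 0"
  shows "vclass e + vclass f = vclass (e' + f')"
proof -
  have "vclass e + vclass f = vclass (e \<oplus>\<^sub>d f)"
    by (rule plus_vmonoid.abs_eq) (simp_all add: idempotents_def id mvn_refl)
  also have "\<dots> = vclass (e' + f')"
    using mvn_block_diag [OF assms supported_Least]
    by (subst vclass_eq_iff)
      (simp_all add: dsum_def idem_block_diag supported_Least id idem_orthogonal_sum orth)
  finally show ?thesis .
qed

lemma vclass_plus:
  fixes e f :: "'a minf"
  assumes "e * e = e" "f * f = f" "supported n e"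
  shows "vclass e + vclass f = vclass (block_diag n e f)"
  unfolding block_diag_eq [OF assms(3)]
  by (rule vclass_plus_orthogonal)
    (simp_all add: assms shift_mult shift_orthogonal mvn_refl mvn_sym [OF mvn_shift])

instance
proof
  fix x y z :: "'a vmonoid"
  obtain e where e: "e * e = e" "x = vclass e" by (rule vclass_cases)
  obtain f where f: "f * f = f" "y = vclass f" by (rule vclass_cases)
  obtain g where g: "g * g = g" "z = vclass g" by (rule vclass_cases)
  obtain n where n: "supported n e" using supported_exists by blast
  let ?f = "shift n f"
  have f': "?f * ?f = ?f" "mvn f ?f"
    by (simp_all add: shift_mult f mvn_sym [OF mvn_shift])
  have ef: "e * ?f = 0" "?f * e = 0" by (simp_all add: shift_orthogonal n)
  obtain k where "supported k ?f" using supported_exists by blast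
  then obtain m where m: "supported m e" "supported m ?f"
    using n supported_mono [of n e "n + k"] supported_mono [of k ?f "n + k"] by auto
  let ?g = "shift m g"
  have g': "?g * ?g = ?g" "mvn g ?g"
    by (simp_all add: shift_mult g mvn_sym [OF mvn_shift])
  have o: "e * ?g = 0" "?g * e = 0" "?f * ?g = 0" "?g * ?f = 0"
    by (simp_all add: shift_orthogonal m)
  have r: "mvn e e" "mvn ?f ?f" "mvn ?g ?g" using e f' g' by (simp_all add: mvn_refl)
  have i: "(e + ?f) * (e + ?f) = e + ?f" "(?f + ?g) * (?f + ?g) = ?f + ?g"
    using e f' g' ef o by (simp_all add: idem_orthogonal_sum)
  have o2: "(e + ?f) * ?g = 0" "?g * (e + ?f) = 0" "e * (?f + ?g) = 0" "(?f + ?g) * e = 0"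
    using o ef by (simp_all add: distrib_left distrib_right)
  have xy: "x + y = vclass (e + ?f)"
    unfolding e(2) f(2) by (rule vclass_plus_orthogonal) (simp_all add: e f f' ef r)
  have yx: "y + x = vclass (?f + e)"
    unfolding e(2) f(2) by (rule vclass_plus_orthogonal) (simp_all add: e f f' ef r)
  show "x + y = y + x" using xy yx by (simp add: add.commute)
  have yz: "y + z = vclass (?f + ?g)"
    unfolding f(2) g(2) by (rule vclass_plus_orthogonal) (simp_all add: f g f' g' o)
  have "x + y + z = vclass (e + ?f + ?g)"
    unfolding xy g(2) by (rule vclass_plus_orthogonal)
      (simp_all add: i g g' o2 mvn_refl)
  also have "\<dots> = vclass (e + (?f + ?g))" by (simp add: add.assoc)
  also have "\<dots> = x + (y + z)"
    unfolding yz unfolding e(2) by (rule vclass_plus_orthogonal [symmetric])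
      (simp_all add: i e o2 mvn_refl)
  finally show "x + y + z = x + (y + z)" .
  have "vclass 0 + vclass e = vclass (0 + e)"
    by (rule vclass_plus_orthogonal) (simp_all add: e mvn_refl)
  then show "0 + x = x" by (simp add: e(2) zero_vmonoid_def)
qed

end

definition order_ideal :: "'m::comm_monoid_add set \<Rightarrow> bool" where
  "order_ideal I \<longleftrightarrow> 0 \<in> I \<and> (\<forall>x\<in>I. \<forall>y\<in>I. x + y \<in> I)
     \<and> (\<forall>x y. x + y \<in> I \<longrightarrow> x \<in> I \<and> y \<in> I)"

definition order_ideals :: "'m::comm_monoid_add set gorder" where
  "order_ideals = \<lparr>carrier = Collect order_ideal, eq = (=), le = (\<subseteq>)\<rparr>"

definition two_sided_ideal :: "'a::ring set \<Rightarrow> bool" where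
  "two_sided_ideal J \<longleftrightarrow> 0 \<in> J \<and> (\<forall>x\<in>J. \<forall>y\<in>J. x + y \<in> J) \<and> (\<forall>x\<in>J. - x \<in> J)
     \<and> (\<forall>x\<in>J. \<forall>r. r * x \<in> J \<and> x * r \<in> J)"

definition ideal_gen :: "'a::ring set \<Rightarrow> 'a set" where
  "ideal_gen S = two_sided_ideal hull S"

definition trace_ideal :: "'a::ring set \<Rightarrow> bool" where
  "trace_ideal J \<longleftrightarrow> (\<exists>E \<subseteq> idempotents (UNIV :: 'a minf set). J = ideal_gen (\<Union>e\<in>E. entries e))"

definition trace_ideals :: "'a::ring set gorder" where
  "trace_ideals = \<lparr>carrier = Collect trace_ideal, eq = (=), le = (\<subseteq>)\<rparr>"

lemma two_sided_ideal_Inter: "(\<And>J. J \<in> \<J> \<Longrightarrow> two_sided_ideal J) \<Longrightarrow> two_sided_ideal (\<Inter>\<J>)"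
  unfolding two_sided_ideal_def by blast

lemma two_sided_ideal_gen: "two_sided_ideal (ideal_gen S)"
  unfolding ideal_gen_def by (rule hull_in) (rule two_sided_ideal_Inter, blast)

interpretation order_ideals: complete_lattice "order_ideals :: 'm::comm_monoid_add set gorder"
proof -
  let ?L = "order_ideals :: 'm set gorder"
  interpret partial_order ?L
    by standard (auto simp: order_ideals_def)
  have Int: "order_ideal (\<Inter>\<A>)" if "\<A> \<subseteq> Collect order_ideal" for \<A> :: "'m set set"
    using that unfolding order_ideal_def by blast
  show "complete_lattice ?L"
  proof (rule complete_latticeI)
    fix \<A> assume A: "\<A> \<subseteq> carrier ?L"
    show "\<exists>s. least ?L s (Upper ?L \<A>)"
      using Int [of "{I. order_ideal I \<and> (\<forall>A\<in>\<A>. A \<subseteq> I)}"] A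
      by (intro exI [of _ "\<Inter>{I. order_ideal I \<and> (\<forall>A\<in>\<A>. A \<subseteq> I)}"])
        (auto simp: least_def Upper_def order_ideals_def)
    show "\<exists>i. greatest ?L i (Lower ?L \<A>)"
      using Int [of \<A>] A
      by (intro exI [of _ "\<Inter>\<A>"])
        (auto simp: greatest_def Lower_def order_ideals_def)
  qed
qed

lemma trace_ideal_Union:
  assumes "\<And>J. J \<in> \<J> \<Longrightarrow> trace_ideal J"
  shows "trace_ideal (ideal_gen (\<Union>\<J>))"
proof -
  obtain E where E: "\<And>J. J \<in> \<J> \<Longrightarrow> E J \<subseteq> idempotents UNIV \<and> J = ideal_gen (\<Union>e\<in>E J. entries e)"
    using assms unfolding trace_ideal_def by metis
  have "ideal_gen (\<Union>\<J>) = ideal_gen (\<Union>e\<in>(\<Union>J\<in>\<J>. E J). entries e)" (is "_ = ideal_gen ?S")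
  proof
    have "(\<Union>e\<in>E J. entries e) \<subseteq> ?S" if "J \<in> \<J>" for J
      using that by blast
    then have "J \<subseteq> ideal_gen ?S" if "J \<in> \<J>" for J
      using E that unfolding ideal_gen_def by (metis hull_mono)
    then show "ideal_gen (\<Union>\<J>) \<subseteq> ideal_gen ?S"
      using two_sided_ideal_gen [of ?S] unfolding ideal_gen_def
      by (intro hull_minimal) auto
    have "(\<Union>e\<in>E J. entries e) \<subseteq> J" if "J \<in> \<J>" for J
      using E that unfolding ideal_gen_def by (metis hull_subset)
    then have "?S \<subseteq> \<Union>\<J>" by blast
    then show "ideal_gen ?S \<subseteq> ideal_gen (\<Union>\<J>)"
      unfolding ideal_gen_def by (rule hull_mono)
  qed
  moreover have "(\<Union>J\<in>\<J>. E J) \<subseteq> idempotents UNIV" using E by blast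
  ultimately show ?thesis unfolding trace_ideal_def by blast
qed

lemma trace_ideal_two_sided: "trace_ideal J \<Longrightarrow> two_sided_ideal J"
  unfolding trace_ideal_def using two_sided_ideal_gen by auto

interpretation trace_ideals: complete_lattice "trace_ideals :: 'a::ring set gorder"
proof -
  let ?L = "trace_ideals :: 'a set gorder"
  interpret partial_order ?L
    by standard (auto simp: trace_ideals_def)
  have min: "ideal_gen (\<Union>\<B>) \<subseteq> J" if "trace_ideal J" "\<And>B. B \<in> \<B> \<Longrightarrow> B \<subseteq> J"
    for \<B> and J :: "'a set"
    unfolding ideal_gen_def
    by (rule hull_minimal) (use that trace_ideal_two_sided in auto)
  have up: "B \<subseteq> ideal_gen (\<Union>\<B>)" if "B \<in> \<B>" for \<B> and B :: "'a set"
    using that unfolding ideal_gen_def by (meson Sup_upper hull_subset order_trans)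
  show "complete_lattice ?L"
  proof (rule complete_latticeI)
    fix \<A> assume A: "\<A> \<subseteq> carrier ?L"
    have U: "trace_ideal (ideal_gen (\<Union>\<A>))"
      using A by (intro trace_ideal_Union) (auto simp: trace_ideals_def)
    have U2: "X \<subseteq> ideal_gen (\<Union>\<A>)" if "X \<in> \<A>" for X
      using that by (rule up)
    have U3: "ideal_gen (\<Union>\<A>) \<subseteq> J" if "trace_ideal J" "\<forall>X\<in>\<A>. X \<subseteq> J" for J
      using that by (intro min) auto
    show "\<exists>s. least ?L s (Upper ?L \<A>)"
    proof (intro exI)
      show "least ?L (ideal_gen (\<Union>\<A>)) (Upper ?L \<A>)"
        unfolding least_def Upper_def trace_ideals_def gorder.simps partial_object.simps
          eq_object.simps
      proof (intro conjI ballI)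
        show "ideal_gen (\<Union>\<A>)
          \<in> {u. \<forall>X. X \<in> \<A> \<inter> Collect trace_ideal \<longrightarrow> X \<subseteq> u} \<inter> Collect trace_ideal"
          using U U2 by blast
      next
        fix J assume "J \<in> {u. \<forall>X. X \<in> \<A> \<inter> Collect trace_ideal \<longrightarrow> X \<subseteq> u} \<inter> Collect trace_ideal"
        then have "trace_ideal J" "\<forall>X\<in>\<A>. X \<subseteq> J"
          using A by (auto simp: trace_ideals_def)
        then show "ideal_gen (\<Union>\<A>) \<subseteq> J" by (rule U3)
      qed blast
    qed
    let ?B = "{B. trace_ideal B \<and> (\<forall>A\<in>\<A>. B \<subseteq> A)}"
    have B: "trace_ideal (ideal_gen (\<Union>?B))"
      by (rule trace_ideal_Union) auto
    have B2: "ideal_gen (\<Union>?B) \<subseteq> X" if "X \<in> \<A>" for X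
      using that A by (intro min) (auto simp: trace_ideals_def)
    have B3: "X \<subseteq> ideal_gen (\<Union>?B)" if "X \<in> ?B" for X
      using that by (rule up)
    show "\<exists>i. greatest ?L i (Lower ?L \<A>)"
    proof (intro exI)
      show "greatest ?L (ideal_gen (\<Union>?B)) (Lower ?L \<A>)"
        unfolding greatest_def Lower_def trace_ideals_def gorder.simps partial_object.simps
          eq_object.simps
      proof (intro conjI ballI)
        show "ideal_gen (\<Union>?B)
          \<in> {l. \<forall>X. X \<in> \<A> \<inter> Collect trace_ideal \<longrightarrow> l \<subseteq> X} \<inter> Collect trace_ideal"
          using B B2 by blast
      next
        fix J assume "J \<in> {l. \<forall>X. X \<in> \<A> \<inter> Collect trace_ideal \<longrightarrow> l \<subseteq> X} \<inter> Collect trace_ideal"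
        then have "J \<in> ?B"
          using A by (auto simp: trace_ideals_def)
        then show "J \<subseteq> ideal_gen (\<Union>?B)" by (rule B3)
      qed blast
    qed
  qed
qed

text \<open>\<^const>\<open>join_pres\<close> and \<^const>\<open>meet_pres\<close> include that both structures are lattices.\<close>

definition lattice_iso ::
    "('x, 'c) gorder_scheme \<Rightarrow> ('y, 'd) gorder_scheme \<Rightarrow> ('x \<Rightarrow> 'y) \<Rightarrow> bool" where
  "lattice_iso X Y h \<longleftrightarrow>
     bij_betw h (carrier X) (carrier Y) \<and> join_pres X Y h \<and> meet_pres X Y h"

definition Phi :: "'a::ring vmonoid set \<Rightarrow> 'a set" where
  "Phi I = ideal_gen (\<Union>e\<in>{e \<in> idempotents UNIV. vclass e \<in> I}. entries e)"

definition Psi :: "'a::ring set \<Rightarrow> 'a vmonoid set" where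
  "Psi J = {vclass e | e. e \<in> idempotents (Mat_over J)}"

end

theory Submission
  imports Defs
begin

text \<open>
  Both maps are monotone, so it suffices to see that they are mutually inverse.  Two facts about
  \<open>M = M\<^sub>\<infinity>(R)\<close> carry the proof.

  An idempotent of \<open>M\<close> that is Murray--von Neumann equivalent to an element \<open>f = y x\<close> of a two-sided
  ideal \<open>K\<close> of \<open>M\<close> lies in \<open>K\<close>, because \<open>e = x y\<close> gives \<open>e = e e = x f y\<close>.  With \<open>K\<close> the matrices over
  an ideal \<open>J\<close> of \<open>R\<close>, this shows that \<open>[e] \<in> \<Psi>(J)\<close> says exactly that \<open>e\<close> has its entries in \<open>J\<close>
  (\<open>vclass_mem_Psi_iff\<close>); hence \<open>\<Psi>(J)\<close> is an order-ideal and \<open>\<Phi>(\<Psi>(J)) = J\<close> for a trace ideal \<open>J\<close>.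

  For an order-ideal \<open>I\<close>, let \<open>K\<close> be the set of all \<open>x e y\<close> with \<open>[e] \<in> I\<close>.  It is a two-sided ideal of
  \<open>M\<close>: a sum of two such products factors through an orthogonal sum of the two idempotents
  (\<open>two_sided_ideal_factoring\<close>).  If an idempotent \<open>f\<close> factors as \<open>x e y\<close>, then \<open>f\<close> is equivalent to
  a direct summand of \<open>e\<close>, so \<open>[f] \<in> I\<close> (\<open>factoring_idempotent_summand\<close>).  To conclude that
  \<open>\<Psi>(\<Phi>(I)) \<subseteq> I\<close>, every matrix over \<open>\<Phi>(I)\<close> must lie in \<open>K\<close>.  If \<open>R\<close> has no unit, the entries of
  an element of \<open>K\<close> cannot be isolated by matrix units, but those of an idempotent \<open>e\<close> can: in
  \<open>e = e e e\<close> the outer factors supply the missing coefficients (\<open>single_entry_mem\<close>).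
\<close>

section \<open>Lattice isomorphisms from monotone inverse maps\<close>

text \<open>
  Monotonicity of \<open>h\<close> alone gives only \<open>h x \<squnion> h y \<sqsubseteq> h (x \<squnion> y)\<close>; pulling the upper bound
  \<open>h x \<squnion> h y\<close> back along the monotone inverse gives the other direction.
\<close>

lemma lattice_isoI:
  assumes X: "lattice X" and Y: "lattice Y"
    and h: "h \<in> carrier X \<rightarrow> carrier Y" and k: "k \<in> carrier Y \<rightarrow> carrier X"
    and kh: "\<And>x. x \<in> carrier X \<Longrightarrow> k (h x) = x" and hk: "\<And>y. y \<in> carrier Y \<Longrightarrow> h (k y) = y"
    and mono_h: "\<And>x x'. x \<in> carrier X \<Longrightarrow> x' \<in> carrier X \<Longrightarrow> x \<sqsubseteq>\<^bsub>X\<^esub> x' \<Longrightarrow> h x \<sqsubseteq>\<^bsub>Y\<^esub> h x'"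
    and mono_k: "\<And>y y'. y \<in> carrier Y \<Longrightarrow> y' \<in> carrier Y \<Longrightarrow> y \<sqsubseteq>\<^bsub>Y\<^esub> y' \<Longrightarrow> k y \<sqsubseteq>\<^bsub>X\<^esub> k y'"
  shows "lattice_iso X Y h"
proof -
  interpret X: lattice X by (rule X)
  interpret Y: lattice Y by (rule Y)
  have hc: "h x \<in> carrier Y" if "x \<in> carrier X" for x using h that by blast
  have kc: "k y \<in> carrier X" if "y \<in> carrier Y" for y using k that by blast
  have bij: "bij_betw h (carrier X) (carrier Y)"
    by (rule bij_betw_byWitness [of _ k]) (use hc kc kh hk in auto)
  have join: "h (x \<squnion>\<^bsub>X\<^esub> y) = h x \<squnion>\<^bsub>Y\<^esub> h y" if c: "x \<in> carrier X" "y \<in> carrier X" for x y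
  proof (rule Y.le_antisym)
    let ?u = "h x \<squnion>\<^bsub>Y\<^esub> h y"
    have u: "?u \<in> carrier Y" "h x \<sqsubseteq>\<^bsub>Y\<^esub> ?u" "h y \<sqsubseteq>\<^bsub>Y\<^esub> ?u"
      using c hc Y.join_left Y.join_right by auto
    have "x \<sqsubseteq>\<^bsub>X\<^esub> k ?u" "y \<sqsubseteq>\<^bsub>X\<^esub> k ?u"
      using mono_k [OF hc u(1) u(2)] mono_k [OF hc u(1) u(3)] c kh by auto
    then have "x \<squnion>\<^bsub>X\<^esub> y \<sqsubseteq>\<^bsub>X\<^esub> k ?u" using c u kc by (intro X.join_le) auto
    then show "h (x \<squnion>\<^bsub>X\<^esub> y) \<sqsubseteq>\<^bsub>Y\<^esub> ?u"
      using mono_h [of "x \<squnion>\<^bsub>X\<^esub> y" "k ?u"] c u kc hk by auto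
    show "?u \<sqsubseteq>\<^bsub>Y\<^esub> h (x \<squnion>\<^bsub>X\<^esub> y)"
      using c hc mono_h X.join_left X.join_right by (intro Y.join_le) auto
  qed (use c hc in auto)
  have meet: "h (x \<sqinter>\<^bsub>X\<^esub> y) = h x \<sqinter>\<^bsub>Y\<^esub> h y" if c: "x \<in> carrier X" "y \<in> carrier X" for x y
  proof (rule Y.le_antisym)
    let ?u = "h x \<sqinter>\<^bsub>Y\<^esub> h y"
    have u: "?u \<in> carrier Y" "?u \<sqsubseteq>\<^bsub>Y\<^esub> h x" "?u \<sqsubseteq>\<^bsub>Y\<^esub> h y"
      using c hc Y.meet_left Y.meet_right by auto
    have "k ?u \<sqsubseteq>\<^bsub>X\<^esub> x" "k ?u \<sqsubseteq>\<^bsub>X\<^esub> y"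
      using mono_k [OF u(1) hc u(2)] mono_k [OF u(1) hc u(3)] c kh by auto
    then have "k ?u \<sqsubseteq>\<^bsub>X\<^esub> x \<sqinter>\<^bsub>X\<^esub> y" using c u kc by (intro X.meet_le) auto
    then show "?u \<sqsubseteq>\<^bsub>Y\<^esub> h (x \<sqinter>\<^bsub>X\<^esub> y)"
      using mono_h [of "k ?u" "x \<sqinter>\<^bsub>X\<^esub> y"] c u kc hk by auto
    show "h (x \<sqinter>\<^bsub>X\<^esub> y) \<sqsubseteq>\<^bsub>Y\<^esub> ?u"
      using c hc mono_h X.meet_left X.meet_right by (intro Y.meet_le) auto
  qed (use c hc in auto)
  show ?thesis
    unfolding lattice_iso_def join_pres_def meet_pres_def
    using X Y bij join meet by blast
qed

section \<open>Ideals of the matrix ring\<close>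

lemma two_sided_ideal_sum:
  assumes "two_sided_ideal J" "\<And>a. a \<in> A \<Longrightarrow> g a \<in> J"
  shows "sum g A \<in> J"
  using assms by (induction A rule: infinite_finite_induct) (auto simp: two_sided_ideal_def)

lemma entry_sum: "entry (sum g A) i j = (\<Sum>a\<in>A. entry (g a) i j)"
  by (induction A rule: infinite_finite_induct) (auto simp: zero_minf.rep_eq plus_minf.rep_eq)

lift_definition single :: "nat \<Rightarrow> nat \<Rightarrow> 'a::zero \<Rightarrow> 'a minf"
  is "\<lambda>i j r a b. if a = i \<and> b = j then r else 0"
  subgoal for i j r
    by (rule finite_subset [of _ "{(i, j)}"]) auto
  done

lemma supported_single: "supported (Suc (i + j)) (single i j r)"
  by (auto simp: supported_def single.rep_eq)

lemma single_add: "single i j (r + s) = single i j r + single i j (s :: 'a::ring)"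
  by (rule minf_eqI) (simp add: single.rep_eq plus_minf.rep_eq)

lemma single_uminus: "single i j (- r) = - single i j (r :: 'a::ring)"
  by (rule minf_eqI) (simp add: single.rep_eq uminus_minf.rep_eq)

lemma single_zero: "single i j (0 :: 'a::ring) = 0"
  by (rule minf_eqI) (simp add: single.rep_eq zero_minf.rep_eq)

lemma single_sum: "single i j (sum g A) = (\<Sum>a\<in>A. single i j (g a :: 'a::ring))"
  by (induction A rule: infinite_finite_induct) (auto simp: single_zero single_add)

lemma entry_single_times:
  fixes A :: "'a::ring minf"
  shows "entry (single i k r * A) a b = (if a = i then r * entry A k b else 0)"
proof -
  have "entry (single i k r * A) a b
      = (\<Sum>l<Suc (i + k). entry (single i k r) a l * entry A l b)"
    by (intro entry_times_minf disjI1 supported_single)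
  also have "\<dots> = (\<Sum>l<Suc (i + k). if k = l then (if a = i then r * entry A k b else 0) else 0)"
    by (rule sum.cong) (auto simp: single.rep_eq)
  finally show ?thesis by simp
qed

lemma entry_times_single:
  fixes A :: "'a::ring minf"
  shows "entry (A * single l j s) a b = (if b = j then entry A a l * s else 0)"
proof -
  have "entry (A * single l j s) a b
      = (\<Sum>k<Suc (l + j). entry A a k * entry (single l j s) k b)"
    by (intro entry_times_minf disjI2 supported_single)
  also have "\<dots> = (\<Sum>k<Suc (l + j). if l = k then (if b = j then entry A a l * s else 0) else 0)"
    by (rule sum.cong) (auto simp: single.rep_eq)
  finally show ?thesis by simp
qed

lemma single_times_single:
  "single i k r * single k j s = single i j (r * s :: 'a::ring)"
  by (rule minf_eqI) (simp add: entry_single_times single.rep_eq)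

lemma single_times_times_single:
  fixes A :: "'a::ring minf"
  shows "single i k r * A * single l j s = single i j (r * entry A k l * s)"
  by (rule minf_eqI) (simp add: entry_single_times entry_times_single single.rep_eq)

lemma minf_eq_sum_single:
  fixes A :: "'a::ring minf"
  assumes "supported n A"
  shows "A = (\<Sum>i<n. \<Sum>j<n. single i j (entry A i j))"
proof (rule minf_eqI)
  fix a b
  have "(\<Sum>i<n. \<Sum>j<n. entry (single i j (entry A i j)) a b)
      = (\<Sum>i<n. if a = i then (\<Sum>j<n. if b = j then entry A a b else 0) else 0)"
    by (intro sum.cong) (auto simp: single.rep_eq intro!: sum.cong sum.neutral)
  also have "\<dots> = entry A a b"
    using supported_zeroD [OF assms, of a b] supported_zeroD [OF assms, of b a]
    by (auto simp: not_less)
  finally show "entry A a b = entry (\<Sum>i<n. \<Sum>j<n. single i j (entry A i j)) a b"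
    by (simp add: entry_sum)
qed

lemma two_sided_ideal_Mat_over:
  assumes J: "two_sided_ideal (J :: 'a::ring set)"
  shows "two_sided_ideal (Mat_over J)"
proof -
  have mem: "A \<in> Mat_over J \<longleftrightarrow> (\<forall>i j. entry A i j \<in> J)" for A :: "'a minf"
    by (auto simp: Mat_over_def entries_def)
  have "A * B \<in> Mat_over J \<and> B * A \<in> Mat_over J" if A: "A \<in> Mat_over J" for A B :: "'a minf"
  proof -
    obtain n where n: "supported n A" using supported_exists by blast
    show ?thesis
      using J A by (auto simp: mem entry_times_minf [of n] n two_sided_ideal_def
          intro!: two_sided_ideal_sum [OF J])
  qed
  then show ?thesis
    using J unfolding two_sided_ideal_def
    by (simp add: mem zero_minf.rep_eq plus_minf.rep_eq uminus_minf.rep_eq)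
qed

text \<open>
  These coefficients absorb multiplication because \<open>E\<^sub>i\<^sub>j(r s) = E\<^sub>i\<^sub>i(r) E\<^sub>i\<^sub>j(s)\<close>, where
  \<open>E\<^sub>i\<^sub>j(r)\<close> is the matrix with \<open>r\<close> at position \<open>(i, j)\<close>.
\<close>

lemma two_sided_ideal_single_coefficients:
  assumes K: "two_sided_ideal (K :: 'a::ring minf set)"
  shows "two_sided_ideal {r. \<forall>i j. single i j r \<in> K}"
proof -
  have "single i j (r * s) \<in> K \<and> single i j (s * r) \<in> K" if "\<forall>i j. single i j s \<in> K" for r s i j
    using K that single_times_single [of i i r j s] single_times_single [of i j s j r]
    unfolding two_sided_ideal_def by metis
  then show ?thesis
    using K unfolding two_sided_ideal_def
    by (simp add: single_zero single_add single_uminus)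
qed

text \<open>
  Writing \<open>e = e e e\<close> makes the entry at \<open>(k, l)\<close> a sum of terms \<open>r e\<^sub>a\<^sub>b s\<close> with \<open>r\<close> and \<open>s\<close> themselves
  entries of \<open>e\<close>, and \<open>E\<^sub>i\<^sub>a(r) e E\<^sub>b\<^sub>j(s)\<close> is exactly this term placed at \<open>(i, j)\<close>.  In a unital
  ring \<open>r = s = 1\<close> would serve.
\<close>

lemma single_entry_mem:
  fixes e :: "'a::ring minf"
  assumes K: "two_sided_ideal K" and e: "e * e = e" "e \<in> K"
  shows "single i j (entry e k l) \<in> K"
proof -
  obtain n where n: "supported n e" using supported_exists by blast
  have "entry e k l = entry (e * e * e) k l" by (simp add: e)
  also have "\<dots> = (\<Sum>b<n. \<Sum>a<n. entry e k a * entry e a b * entry e b l)"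
    by (simp only: entry_times_minf [of n] n simp_thms sum_distrib_right)
  finally have "single i j (entry e k l)
      = (\<Sum>b<n. \<Sum>a<n. single i a (entry e k a) * e * single b j (entry e b l))"
    by (simp add: single_sum single_times_times_single)
  also have "\<dots> \<in> K"
    using K e(2) by (intro two_sided_ideal_sum [OF K]) (simp add: two_sided_ideal_def)
  finally show ?thesis .
qed

lemma Mat_over_ideal_gen_subset:
  fixes K :: "'a::ring minf set"
  assumes K: "two_sided_ideal K" and E: "E \<subseteq> idempotents K"
  shows "Mat_over (ideal_gen (\<Union>e\<in>E. entries e)) \<subseteq> K"
proof
  let ?J = "{r. \<forall>i j. single i j r \<in> K}"
  fix A assume A: "A \<in> Mat_over (ideal_gen (\<Union>e\<in>E. entries e))"
  have "(\<Union>e\<in>E. entries e) \<subseteq> ?J"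
    using E single_entry_mem [OF K] by (fastforce simp: entries_def idempotents_def)
  then have "ideal_gen (\<Union>e\<in>E. entries e) \<subseteq> ?J"
    unfolding ideal_gen_def
    by (rule hull_minimal) (rule two_sided_ideal_single_coefficients [OF K])
  then have s: "single i j (entry A i j) \<in> K" for i j
    using A by (auto simp: Mat_over_def entries_def)
  obtain n where "supported n A" using supported_exists by blast
  then have "A = (\<Sum>i<n. \<Sum>j<n. single i j (entry A i j))" by (rule minf_eq_sum_single)
  moreover have "\<dots> \<in> K" by (intro two_sided_ideal_sum [OF K] s)
  ultimately show "A \<in> K" by simp
qed

section \<open>Murray--von Neumann classes, ideals and order-ideals\<close>

lemma mvn_factor:
  fixes e f :: "'b::ring"
  assumes "e * e = e" "mvn e f"
  obtains x y where "e = x * f * y"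
proof -
  obtain x y where *: "e = x * y" "f = y * x" using assms(2) unfolding mvn_def by blast
  have "e = x * f * y" using assms(1) * by (simp add: mult.assoc)
  then show thesis by (rule that)
qed

lemma mvn_mem_ideal:
  fixes e f :: "'b::ring"
  assumes K: "two_sided_ideal K" and "e * e = e" "mvn e f" "f \<in> K"
  shows "e \<in> K"
proof -
  obtain x y where "e = x * f * y" using mvn_factor [OF assms(2,3)] .
  then show ?thesis using K assms(4) by (simp add: two_sided_ideal_def)
qed

lemma vclass_plus_orthogonalE:
  fixes e f :: "'a::ring minf"
  assumes "e * e = e" "f * f = f"
  obtains f' where "f' * f' = f'" "mvn f f'" "e * f' = 0" "f' * e = 0"
    "vclass e + vclass f = vclass (e + f')"
proof -
  obtain n where n: "supported n e" using supported_exists by blast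
  show thesis
  proof (rule that [of "shift n f"])
    show "vclass e + vclass f = vclass (e + shift n f)"
      using vclass_plus [OF assms n] by (simp add: block_diag_eq n)
  qed (simp_all add: assms n shift_mult shift_orthogonal mvn_sym [OF mvn_shift])
qed

lemma vclass_mem_Psi_iff:
  fixes e :: "'a::ring minf"
  assumes J: "two_sided_ideal J" and e: "e * e = e"
  shows "vclass e \<in> Psi J \<longleftrightarrow> e \<in> Mat_over J"
proof
  assume "vclass e \<in> Psi J"
  then obtain f where "f * f = f" "f \<in> Mat_over J" "vclass e = vclass f"
    by (auto simp: Psi_def idempotents_def)
  then show "e \<in> Mat_over J"
    using mvn_mem_ideal [OF two_sided_ideal_Mat_over [OF J] e] vclass_eq_iff [OF e] by blast
qed (use e in \<open>auto simp: Psi_def idempotents_def\<close>)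

text \<open>
  If \<open>e\<close> and \<open>f'\<close> are orthogonal idempotents, then \<open>e = e (e + f')\<close> and \<open>f' = f' (e + f')\<close>; so an
  ideal contains the orthogonal sum exactly when it contains both summands.
\<close>

lemma order_ideal_Psi:
  assumes J: "two_sided_ideal (J :: 'a::ring set)"
  shows "order_ideal (Psi J)"
proof -
  let ?K = "Mat_over J"
  have K: "two_sided_ideal ?K" by (rule two_sided_ideal_Mat_over [OF J])
  have "0 \<in> ?K" using K by (simp add: two_sided_ideal_def)
  then have zero: "0 \<in> Psi J"
    unfolding zero_vmonoid_def by (simp add: vclass_mem_Psi_iff [OF J])
  have plus: "x + y \<in> Psi J \<longleftrightarrow> x \<in> Psi J \<and> y \<in> Psi J" for x y :: "'a vmonoid"
  proof -
    obtain e where e: "e * e = e" "x = vclass e" by (rule vclass_cases)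
    obtain f where f: "f * f = f" "y = vclass f" by (rule vclass_cases)
    obtain f' where f': "f' * f' = f'" "mvn f f'" "e * f' = 0" "f' * e = 0"
      and xy: "x + y = vclass (e + f')"
      using vclass_plus_orthogonalE [OF e(1) f(1)] e f by metis
    have "e * (e + f') = e" "f' * (e + f') = f'" using e f' by (simp_all add: distrib_left)
    then have "e + f' \<in> ?K \<longleftrightarrow> e \<in> ?K \<and> f' \<in> ?K"
      using K unfolding two_sided_ideal_def by metis
    moreover have "f' \<in> ?K \<longleftrightarrow> f \<in> ?K"
      using mvn_mem_ideal [OF K] f(1) f'(1,2) mvn_sym by blast
    ultimately show ?thesis
      using e f f' xy vclass_mem_Psi_iff [OF J] idem_orthogonal_sum [of e f'] by simp
  qed
  show ?thesis unfolding order_ideal_def using zero plus by blast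
qed

text \<open>
  After replacing \<open>x\<close> by \<open>f x e\<close> and \<open>y\<close> by \<open>e y f\<close>, the product \<open>y x\<close> is an idempotent below \<open>e\<close> that
  is equivalent to \<open>f\<close>; its complement in \<open>e\<close> gives the second summand.
\<close>

lemma factoring_idempotent_summand:
  fixes e f :: "'a::ring minf"
  assumes e: "e * e = e" and f: "f * f = f" "f = x * e * y"
  obtains z where "vclass e = vclass f + z"
proof -
  define u where "u = f * x * e"
  define v where "v = e * y * f"
  define p where "p = v * u"
  have ee: "e * (e * a) = e * a" and ff: "f * (f * a) = f * a" for a
    using e f(1) by (simp_all flip: mult.assoc)
  have "u * v = f * (x * e * y) * f"
    by (simp add: u_def v_def mult.assoc ee)
  then have uv: "u * v = f" using f by simp
  have ef: "f * u = u" "u * e = u" "e * v = v"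
    by (simp_all add: u_def v_def mult.assoc e ee ff)
  have p: "p * p = p" "e * p = p" "p * e = p"
  proof -
    have "p * p = v * ((u * v) * u)" by (simp add: p_def mult.assoc)
    then show "p * p = p" by (simp add: uv ef p_def)
    show "e * p = p" using ef(3) by (simp add: p_def flip: mult.assoc)
    show "p * e = p" using ef(2) by (simp add: p_def mult.assoc)
  qed
  have q: "(e - p) * (e - p) = e - p" "p * (e - p) = 0" "(e - p) * p = 0"
    using e p by (simp_all add: left_diff_distrib right_diff_distrib)
  have "mvn f p" unfolding mvn_def p_def using uv by metis
  then have "vclass f + vclass (e - p) = vclass (p + (e - p))"
    using f(1) p q by (intro vclass_plus_orthogonal) (auto intro: mvn_refl)
  then show thesis by (intro that [of "vclass (e - p)"]) simp
qed

text \<open>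
  For the sum of \<open>x e y\<close> and \<open>z f w\<close>, the second idempotent is first replaced by an equivalent one
  orthogonal to \<open>e\<close>; then both products factor through the same idempotent and the mixed terms vanish.
\<close>

lemma two_sided_ideal_factoring:
  fixes I :: "'a::ring vmonoid set"
  assumes I: "order_ideal I"
  shows "two_sided_ideal {x * e * y | x e y. e \<in> idempotents UNIV \<and> vclass e \<in> I}"
    (is "two_sided_ideal ?K")
proof -
  define K where "K = ?K"
  have KI: "x * e * y \<in> K" if "e * e = e" "vclass e \<in> I" for x e y
    using that by (auto simp: K_def idempotents_def)
  have KE: "\<exists>x e y. e * e = e \<and> vclass e \<in> I \<and> A = x * e * y" if "A \<in> K" for A
    using that by (auto simp: K_def idempotents_def)
  have "0 * 0 * 0 \<in> K"
    using I by (intro KI) (simp_all add: order_ideal_def zero_vmonoid_def)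
  then have zero: "0 \<in> K" by simp
  have plus: "A + B \<in> K" if AK: "A \<in> K" and BK: "B \<in> K" for A B
  proof -
    obtain x e y where A: "e * e = e" "vclass e \<in> I" "A = x * e * y"
      using KE [OF AK] by blast
    obtain z f w where B: "f * f = f" "vclass f \<in> I" "B = z * f * w"
      using KE [OF BK] by blast
    obtain g where g: "g * g = g" "mvn f g" "e * g = 0" "g * e = 0"
      and sum: "vclass e + vclass f = vclass (e + g)"
      using vclass_plus_orthogonalE [OF A(1) B(1)] by metis
    obtain u v where uv: "f = u * g * v" using mvn_factor [OF B(1) g(2)] .
    have orth: "e * (e * a) = e * a" "g * (g * a) = g * a" "e * (g * a) = 0" "g * (e * a) = 0" for a
      using A(1) g by (simp_all flip: mult.assoc)
    have "A + B = x * e * y + z * u * g * (v * w)" unfolding A B uv by (simp add: mult.assoc)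
    also have "\<dots> = (x * e + z * u * g) * (e + g) * (e * y + g * (v * w))"
      by (simp add: distrib_left distrib_right mult.assoc orth)
    also have "\<dots> \<in> K"
    proof (rule KI)
      show "(e + g) * (e + g) = e + g" by (rule idem_orthogonal_sum [OF A(1) g(1,3,4)])
      show "vclass (e + g) \<in> I"
        using I A(2) B(2) unfolding order_ideal_def sum [symmetric] by blast
    qed
    finally show ?thesis .
  qed
  have mult: "- A \<in> K" "r * A \<in> K" "A * r \<in> K" if AK: "A \<in> K" for A r
  proof -
    obtain x e y where A: "e * e = e" "vclass e \<in> I" "A = x * e * y"
      using KE [OF AK] by blast
    have "- A = (- x) * e * y" "r * A = (r * x) * e * y" "A * r = x * e * (y * r)"
      unfolding A(3) by (simp_all add: mult.assoc)
    then show "- A \<in> K" "r * A \<in> K" "A * r \<in> K"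
      by (simp_all only: KI [OF A(1,2)])
  qed
  have "two_sided_ideal K"
    unfolding two_sided_ideal_def by (intro conjI ballI allI zero plus mult)
  then show ?thesis by (simp only: K_def)
qed

section \<open>The two maps are mutually inverse\<close>

lemma trace_ideal_Phi: "trace_ideal (Phi I)"
  unfolding trace_ideal_def Phi_def by (intro exI conjI refl) auto

lemma Phi_mono: "I \<subseteq> I' \<Longrightarrow> Phi I \<subseteq> Phi I'"
  unfolding Phi_def ideal_gen_def by (intro hull_mono UN_mono) auto

lemma Psi_mono: "J \<subseteq> J' \<Longrightarrow> Psi J \<subseteq> Psi J'"
  by (auto simp: Psi_def idempotents_def Mat_over_def)

lemma mem_Mat_over_Phi:
  assumes "e * e = e" "vclass e \<in> I"
  shows "e \<in> Mat_over (Phi I)"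
  using assms unfolding Mat_over_def Phi_def ideal_gen_def idempotents_def
  by (auto intro!: hull_inc)

lemma Psi_Phi:
  fixes I :: "'a::ring vmonoid set"
  assumes I: "order_ideal I"
  shows "Psi (Phi I) = I"
proof
  let ?E = "{e \<in> idempotents UNIV. vclass e \<in> I}"
  let ?K = "{x * e * y | x e y. e \<in> idempotents UNIV \<and> vclass e \<in> I}"
  have "e \<in> ?K" if "e \<in> ?E" for e
  proof -
    have "e = e * e * e" using that by (simp add: idempotents_def)
    then show ?thesis using that by blast
  qed
  then have E: "?E \<subseteq> idempotents ?K" by (auto simp: idempotents_def)
  have sub: "Mat_over (Phi I) \<subseteq> ?K"
    unfolding Phi_def by (rule Mat_over_ideal_gen_subset [OF two_sided_ideal_factoring [OF I] E])
  show "Psi (Phi I) \<subseteq> I"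
  proof
    fix a assume "a \<in> Psi (Phi I)"
    then obtain f where f: "a = vclass f" "f * f = f" "f \<in> Mat_over (Phi I)"
      by (auto simp: Psi_def idempotents_def)
    then obtain x e y where e: "e * e = e" "vclass e \<in> I" "f = x * e * y"
      using sub by (auto simp: idempotents_def)
    obtain z where "vclass e = vclass f + z"
      using factoring_idempotent_summand [OF e(1) f(2) e(3)] .
    then show "a \<in> I" using I e(2) f(1) unfolding order_ideal_def by metis
  qed
  show "I \<subseteq> Psi (Phi I)"
  proof
    fix a assume a: "a \<in> I"
    obtain e where e: "e * e = e" "a = vclass e" by (rule vclass_cases)
    with a show "a \<in> Psi (Phi I)"
      using mem_Mat_over_Phi [of e I] by (auto simp: Psi_def idempotents_def)
  qed
qed

lemma Phi_Psi:
  fixes J :: "'a::ring set"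
  assumes J: "trace_ideal J"
  shows "Phi (Psi J) = J"
proof
  have J2: "two_sided_ideal J" by (rule trace_ideal_two_sided [OF J])
  have "(\<Union>e\<in>{e \<in> idempotents UNIV. vclass e \<in> Psi J}. entries e) \<subseteq> J"
    using vclass_mem_Psi_iff [OF J2] by (fastforce simp: idempotents_def Mat_over_def)
  then show "Phi (Psi J) \<subseteq> J"
    unfolding Phi_def ideal_gen_def using J2 by (rule hull_minimal)
  obtain E where E: "E \<subseteq> idempotents UNIV" "J = ideal_gen (\<Union>e\<in>E. entries e)"
    using J unfolding trace_ideal_def by blast
  have "(\<Union>e\<in>E. entries e) \<subseteq> J" unfolding E(2) ideal_gen_def by (rule hull_subset)
  then have "E \<subseteq> {e \<in> idempotents UNIV. vclass e \<in> Psi J}"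
    using E(1) vclass_mem_Psi_iff [OF J2] by (fastforce simp: idempotents_def Mat_over_def)
  then have "ideal_gen (\<Union>e\<in>E. entries e) \<subseteq> Phi (Psi J)"
    unfolding Phi_def ideal_gen_def by (intro hull_mono UN_mono) auto
  then show "J \<subseteq> Phi (Psi J)" using E(2) by simp
qed

theorem proposition10p10:
  shows "lattice_iso (order_ideals :: 'a::ring vmonoid set gorder) (trace_ideals :: 'a set gorder) Phi
    \<and> lattice_iso (trace_ideals :: 'a set gorder) (order_ideals :: 'a vmonoid set gorder) Psi
    \<and> (\<forall>I \<in> carrier (order_ideals :: 'a vmonoid set gorder). Psi (Phi I) = I)
    \<and> (\<forall>J \<in> carrier (trace_ideals :: 'a set gorder). Phi (Psi J) = J)"
proof -
  let ?L = "order_ideals :: 'a vmonoid set gorder" and ?T = "trace_ideals :: 'a set gorder"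
  have lat: "lattice ?L" "lattice ?T" by unfold_locales
  have maps: "Phi \<in> carrier ?L \<rightarrow> carrier ?T" "Psi \<in> carrier ?T \<rightarrow> carrier ?L"
    by (auto simp: order_ideals_def trace_ideals_def trace_ideal_Phi
        intro: order_ideal_Psi trace_ideal_two_sided)
  have inv: "Psi (Phi I) = I" if "I \<in> carrier ?L" for I
    using that by (simp add: order_ideals_def Psi_Phi)
  have inv': "Phi (Psi J) = J" if "J \<in> carrier ?T" for J
    using that by (simp add: trace_ideals_def Phi_Psi)
  have mono: "Phi I \<sqsubseteq>\<^bsub>?T\<^esub> Phi I'" if "I \<sqsubseteq>\<^bsub>?L\<^esub> I'" for I I'
    using that by (simp add: order_ideals_def trace_ideals_def Phi_mono)
  have mono': "Psi J \<sqsubseteq>\<^bsub>?L\<^esub> Psi J'" if "J \<sqsubseteq>\<^bsub>?T\<^esub> J'" for J J'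
    using that by (simp add: order_ideals_def trace_ideals_def Psi_mono)
  show ?thesis
    using lattice_isoI [OF lat maps inv inv' mono mono']
      lattice_isoI [OF lat(2,1) maps(2,1) inv' inv mono' mono] inv inv' by blast
qed

end
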